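(* Let $(\mathfrak g_1,\mathfrak g_2;\rho,\nu,\varrho,\tau)$ be a generalized matched pair of 3-Lie algebras. Then $((\mathfrak g_1\oplus\mathfrak g_2,[\cdot,\cdot,\cdot]_{\mathfrak g_1\oplus\mathfrak g_2}),\mathfrak g_1,\mathfrak g_2)$ is a twilled 3-Lie algebra, where for $x_i\in\mathfrak g_1$, $a_i\in\mathfrak g_2$, $$\begin{aligned}{}[x_1+a_1,x_2+a_2,x_3+a_3]_{\mathfrak g_1\oplus\mathfrak g_2}=&[x_1,x_2,x_3]_{\mathfrak g_1}+\rho(x_1,x_2)(a_3)+\rho(x_2,x_3)(a_1)+\rho(x_3,x_1)(a_2)\\&+\nu(x_1)(a_2\wedge a_3)+\nu(x_2)(a_3\wedge a_1)+\nu(x_3)(a_1\wedge a_2)\\&+[a_1,a_2,a_3]_{\mathfrak g_2}+\varrho(a_1,a_2)(x_3)+\varrho(a_2,a_3)(x_1)+\varrho(a_3,a_1)(x_2)\\&+\tau(a_1)(x_2\wedge x_3)+\tau(a_2)(x_3\wedge x_1)+\tau(a_3)(x_1\wedge x_2).\end{aligned}$$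
   Context: All vector spaces are finite-dimensional over an algebraically closed field of characteristic $0$. **3-Lie algebra.** A vector space with a skew-symmetric trilinear bracket satisfying $[x_1,x_2,[x_3,x_4,x_5]]=[[x_1,x_2,x_3],x_4,x_5]+[x_3,[x_1,x_2,x_4],x_5]+[x_3,x_4,[x_1,x_2,x_5]]$. **Twilled 3-Lie algebra.** A triple $(\mathcal G,\mathfrak g_1,\mathfrak g_2)$ where $\mathcal G$ is a 3-Lie algebra, $\mathcal G=\mathfrak g_1\oplus\mathfrak g_2$ as vector spaces, and $\mathfrak g_1,\mathfrak g_2$ are subalgebras. **Generalized representation.** A generalized representation $(V;\rho,\nu)$ of a 3-Lie algebra $(\mathfrak g,[\cdot,\cdot,\cdot]_{\mathfrak g})$ on a vector space $V$ consists of linear maps $\rho:\wedge^2\mathfrak g\to\mathfrak{gl}(V)$, $\nu:\mathfrak g\to\mathrm{Hom}(\wedge^2V,V)$ such that the skew-symmetric operation on $\mathfrak g\oplus V$ $$(x+u,y+v,z+w)\mapsto[x,y,z]_{\mathfrak g}+\rho(x,y)w+\rho(y,z)u+\rho(z,x)v+\nu(x)(v\wedge w)+\nu(y)(w\wedge u)+\nu(z)(u\wedge v)$$ is a 3-Lie algebra structure on $\mathfrak g\oplus V$. **Generalized matched pair.** Let $(\mathfrak g_1,[\cdot,\cdot,\cdot]_{\mathfrak g_1})$, $(\mathfrak g_2,[\cdot,\cdot,\cdot]_{\mathfrak g_2})$ be 3-Lie algebras with linear maps $\rho:\wedge^2\mathfrak g_1\to\mathfrak{gl}(\mathfrak g_2)$,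 $\nu:\mathfrak g_1\to\mathrm{Hom}(\wedge^2\mathfrak g_2,\mathfrak g_2)$, $\varrho:\wedge^2\mathfrak g_2\to\mathfrak{gl}(\mathfrak g_1)$, $\tau:\mathfrak g_2\to\mathrm{Hom}(\wedge^2\mathfrak g_1,\mathfrak g_1)$. Then $(\mathfrak g_1,\mathfrak g_2;\rho,\nu,\varrho,\tau)$ is a generalized matched pair if $(\mathfrak g_2;\rho,\nu)$ is a generalized representation of $\mathfrak g_1$, $(\mathfrak g_1;\varrho,\tau)$ is a generalized representation of $\mathfrak g_2$, and for all $x_i\in\mathfrak g_1$, $a_i\in\mathfrak g_2$: 1. $\nu([x_1,x_2,x_3]_{\mathfrak g_1})(a_1\wedge a_2)=\rho(x_1,x_2)(\nu(x_3)(a_1\wedge a_2))+\rho(x_3,x_1)(\nu(x_2)(a_1\wedge a_2))+\rho(x_2,x_3)(\nu(x_1)(a_1\wedge a_2))$; 2. $\varrho(a_1,a_2)[x_1,x_2,x_3]_{\mathfrak g_1}=[\varrho(a_1,a_2)x_1,x_2,x_3]_{\mathfrak g_1}+[x_1,\varrho(a_1,a_2)x_2,x_3]_{\mathfrak g_1}+[x_1,x_2,\varrho(a_1,a_2)x_3]_{\mathfrak g_1}+\tau(\nu(x_1)(a_1\wedge a_2))(x_2\wedge x_3)+\tau(\nu(x_2)(a_1\wedge a_2))(x_3\wedge x_1)+\tau(\nu(x_3)(a_1\wedge a_2))(x_1\wedge x_2)$; 3. $[x_1,x_2,\varrho(a_1,a_2)x_3]_{\mathfrak g_1}=\varrho(\rho(x_1,x_2)a_1,a_2)x_3-\varrho(\rho(x_1,x_3)a_2,a_1)x_2+\varrho(\rho(x_2,x_3)a_2,a_1)x_1-\tau(\nu(x_3)(a_1\wedge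 a_2))(x_1\wedge x_2)$; 4. $[\varrho(a_1,a_2)x_1,x_2,x_3]_{\mathfrak g_1}=\varrho(a_1,a_2)[x_1,x_2,x_3]_{\mathfrak g_1}+\varrho(\rho(x_2,x_3)a_1,a_2)x_1+\varrho(a_1,\rho(x_2,x_3)a_2)x_1-\tau(\nu(x_1)(a_1\wedge a_2))(x_2\wedge x_3)$; 5. $[x_1,x_2,\tau(a_1)(x_3\wedge x_4)]_{\mathfrak g_1}=[x_3,x_4,\tau(a_1)(x_1\wedge x_2)]_{\mathfrak g_1}-\tau(\rho(x_3,x_4)a_1)(x_1\wedge x_2)+\tau(a_1)([x_1,x_2,x_3]_{\mathfrak g_1}\wedge x_4)+\tau(a_1)(x_3\wedge[x_1,x_2,x_4]_{\mathfrak g_1})+\tau(\rho(x_1,x_2)a_1)(x_3\wedge x_4)$; 6. $\tau(a_1)(x_1\wedge[x_2,x_3,x_4]_{\mathfrak g_1})=[\tau(a_1)(x_1\wedge x_2),x_3,x_4]_{\mathfrak g_1}+[\tau(a_1)(x_1\wedge x_3),x_4,x_2]_{\mathfrak g_1}+[\tau(a_1)(x_1\wedge x_4),x_2,x_3]_{\mathfrak g_1}+\tau(\rho(x_1,x_2)a_1)(x_3\wedge x_4)+\tau(\rho(x_1,x_3)a_1)(x_4\wedge x_2)+\tau(\rho(x_1,x_4)a_1)(x_2\wedge x_3)$; 7. $\rho(\tau(a_2)(x_1\wedge x_2),x_3)a_1=\rho(\tau(a_2)(x_3\wedge x_2),x_1)a_1+\rho(\tau(a_2)(x_1\wedge x_3),x_2)a_1$;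 8. $\rho(x_1,\tau(a_1)(x_2\wedge x_3))(a_2)=\rho(x_1,\tau(a_2)(x_2\wedge x_3))(a_1)$; 9. $\tau([a_1,a_2,a_3]_{\mathfrak g_2})(x_1\wedge x_2)=\varrho(a_1,a_2)(\tau(a_3)(x_1\wedge x_2))+\varrho(a_3,a_1)(\tau(a_2)(x_1\wedge x_2))+\varrho(a_2,a_3)(\tau(a_1)(x_1\wedge x_2))$; 10. $\rho(x_1,x_2)[a_1,a_2,a_3]_{\mathfrak g_2}=[\rho(x_1,x_2)a_1,a_2,a_3]_{\mathfrak g_2}+[a_1,\rho(x_1,x_2)a_2,a_3]_{\mathfrak g_2}+[a_1,a_2,\rho(x_1,x_2)a_3]_{\mathfrak g_2}+\nu(\tau(a_1)(x_1\wedge x_2))(a_2\wedge a_3)+\nu(\tau(a_2)(x_1\wedge x_2))(a_3\wedge a_1)+\nu(\tau(a_3)(x_1\wedge x_2))(a_1\wedge a_2)$; 11. $[a_1,a_2,\rho(x_1,x_2)a_3]_{\mathfrak g_2}=\rho(\varrho(a_1,a_2)x_1,x_2)a_3-\rho(\varrho(a_1,a_3)x_2,x_1)a_2+\rho(\varrho(a_2,a_3)x_2,x_1)a_1-\nu(\tau(a_3)(x_1\wedge x_2))(a_1\wedge a_2)$; 12. $[\rho(x_1,x_2)a_1,a_2,a_3]_{\mathfrak g_2}=\rho(x_1,x_2)[a_1,a_2,a_3]_{\mathfrak g_2}+\rho(\varrho(a_2,a_3)x_1,x_2)a_1+\rho(x_1,\varrho(a_2,a_3)x_2)a_1-\nu(\tau(a_1)(x_1\wedge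 x_2))(a_2\wedge a_3)$; 13. $[a_1,a_2,\nu(x_1)(a_3\wedge a_4)]_{\mathfrak g_2}=\nu(x_1)([a_1,a_2,a_3]_{\mathfrak g_2}\wedge a_4)+\nu(x_1)(a_3\wedge[a_1,a_2,a_4]_{\mathfrak g_2})+[a_3,a_4,\nu(x_1)(a_1\wedge a_2)]_{\mathfrak g_2}+\nu(\varrho(a_1,a_2)x_1)(a_3\wedge a_4)-\nu(\varrho(a_3,a_4)x_1)(a_1\wedge a_2)$; 14. $\nu(x_1)(a_1\wedge[a_2,a_3,a_4]_{\mathfrak g_2})=\nu(\varrho(a_1,a_2)x_1)(a_3\wedge a_4)+\nu(\varrho(a_1,a_3)x_1)(a_4\wedge a_2)+\nu(\varrho(a_1,a_4)x_1)(a_2\wedge a_3)+[\nu(x_1)(a_1\wedge a_2),a_3,a_4]_{\mathfrak g_2}+[\nu(x_1)(a_1\wedge a_3),a_4,a_2]_{\mathfrak g_2}+[a_2,a_3,\nu(x_1)(a_1\wedge a_4)]_{\mathfrak g_2}$; 15. $\varrho(\nu(x_2)(a_1\wedge a_2),a_3)x_1=\varrho(\nu(x_2)(a_3\wedge a_2),a_1)x_1+\varrho(\nu(x_2)(a_1\wedge a_3),a_2)x_1$; 16. $\varrho(a_1,\nu(x_1)(a_2\wedge a_3))(x_2)=\varrho(a_1,\nu(x_2)(a_2\wedge a_3))(x_1)$. *)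

theory Defs
  imports "HOL-Computational_Algebra.Polynomial" "HOL-Analysis.Product_Vector"
begin

locale fd_vector_space = vector_space scale
  for scale :: "'k::field_char_0 \<Rightarrow> 'v::ab_group_add \<Rightarrow> 'v" +
  assumes finite_dimensional: "\<exists>B. finite B \<and> span B = UNIV"

text \<open>
  Skew-symmetry is required for the two adjacent transpositions, which generate the symmetric
  group on the three arguments; linearity in the other arguments then follows from linearity in
  the first, but is stated anyway.
\<close>

locale three_lie_algebra = fd_vector_space scale
  for scale :: "'k::field_char_0 \<Rightarrow> 'v::ab_group_add \<Rightarrow> 'v" +
  fixes bracket :: "'v \<Rightarrow> 'v \<Rightarrow> 'v \<Rightarrow> 'v"
  assumes linear_1: "\<And>y z. Vector_Spaces.linear scale scale (\<lambda>x. bracket x y z)"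
    and linear_2: "\<And>x z. Vector_Spaces.linear scale scale (\<lambda>y. bracket x y z)"
    and linear_3: "\<And>x y. Vector_Spaces.linear scale scale (\<lambda>z. bracket x y z)"
    and skew_12: "\<And>x y z. bracket y x z = - bracket x y z"
    and skew_23: "\<And>x y z. bracket x z y = - bracket x y z"
    and fundamental_identity:
      "\<And>x1 x2 x3 x4 x5.
         bracket x1 x2 (bracket x3 x4 x5)
         = bracket (bracket x1 x2 x3) x4 x5
           + bracket x3 (bracket x1 x2 x4) x5
           + bracket x3 x4 (bracket x1 x2 x5)"

locale twilled_three_lie_algebra = three_lie_algebra scale bracket
  for scale :: "'k::field_char_0 \<Rightarrow> 'v::ab_group_add \<Rightarrow> 'v"
    and bracket :: "'v \<Rightarrow> 'v \<Rightarrow> 'v \<Rightarrow> 'v" +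
  fixes G1 G2 :: "'v set"
  assumes subspace_1: "subspace G1"
    and subspace_2: "subspace G2"
    and inter_trivial: "G1 \<inter> G2 = {0}"
    and sum_whole: "\<And>v. \<exists>x\<in>G1. \<exists>a\<in>G2. v = x + a"
    and closed_1: "\<And>x y z. \<lbrakk>x \<in> G1; y \<in> G1; z \<in> G1\<rbrakk> \<Longrightarrow> bracket x y z \<in> G1"
    and closed_2: "\<And>x y z. \<lbrakk>x \<in> G2; y \<in> G2; z \<in> G2\<rbrakk> \<Longrightarrow> bracket x y z \<in> G2"

text \<open>
  A linear map from the second exterior power is encoded as an alternating bilinear map, so that
  \<open>\<rho> x y v\<close> is the operator attached to \<open>x \<and> y\<close> applied to \<open>v\<close>,
  and \<open>\<nu> x u v\<close> is the value at \<open>u \<and> v\<close> of the map attached to \<open>x\<close>.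
\<close>

definition linear_wedge2_gl ::
  "('k::field_char_0 \<Rightarrow> 'g::ab_group_add \<Rightarrow> 'g) \<Rightarrow> ('k \<Rightarrow> 'v::ab_group_add \<Rightarrow> 'v)
    \<Rightarrow> ('g \<Rightarrow> 'g \<Rightarrow> 'v \<Rightarrow> 'v) \<Rightarrow> bool" where
  "linear_wedge2_gl sg sv \<rho> \<longleftrightarrow>
     (\<forall>y v. Vector_Spaces.linear sg sv (\<lambda>x. \<rho> x y v)) \<and>
     (\<forall>x v. Vector_Spaces.linear sg sv (\<lambda>y. \<rho> x y v)) \<and>
     (\<forall>x y. Vector_Spaces.linear sv sv (\<rho> x y)) \<and>
     (\<forall>x v. \<rho> x x v = 0)"

definition linear_hom_wedge2 ::
  "('k::field_char_0 \<Rightarrow> 'g::ab_group_add \<Rightarrow> 'g) \<Rightarrow> ('k \<Rightarrow> 'v::ab_group_add \<Rightarrow> 'v)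
    \<Rightarrow> ('g \<Rightarrow> 'v \<Rightarrow> 'v \<Rightarrow> 'v) \<Rightarrow> bool" where
  "linear_hom_wedge2 sg sv \<nu> \<longleftrightarrow>
     (\<forall>u v. Vector_Spaces.linear sg sv (\<lambda>x. \<nu> x u v)) \<and>
     (\<forall>x v. Vector_Spaces.linear sv sv (\<lambda>u. \<nu> x u v)) \<and>
     (\<forall>x u. Vector_Spaces.linear sv sv (\<lambda>v. \<nu> x u v)) \<and>
     (\<forall>x v. \<nu> x v v = 0)"

fun semidirect_bracket ::
  "('g \<Rightarrow> 'g \<Rightarrow> 'g \<Rightarrow> 'g) \<Rightarrow> ('g \<Rightarrow> 'g \<Rightarrow> 'v \<Rightarrow> 'v) \<Rightarrow> ('g \<Rightarrow> 'v \<Rightarrow> 'v \<Rightarrow> 'v)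
    \<Rightarrow> 'g \<times> 'v \<Rightarrow> 'g \<times> 'v \<Rightarrow> 'g \<times> 'v \<Rightarrow> 'g \<times> ('v::ab_group_add)" where
  "semidirect_bracket br \<rho> \<nu> (x, u) (y, v) (z, w) =
     (br x y z,
      \<rho> x y w + \<rho> y z u + \<rho> z x v + \<nu> x v w + \<nu> y w u + \<nu> z u v)"

locale generalized_representation =
  three_lie_algebra scale bracket + V: fd_vector_space scaleV
  for scale :: "'k::field_char_0 \<Rightarrow> 'g::ab_group_add \<Rightarrow> 'g"
    and bracket :: "'g \<Rightarrow> 'g \<Rightarrow> 'g \<Rightarrow> 'g"
    and scaleV :: "'k \<Rightarrow> 'v::ab_group_add \<Rightarrow> 'v" +
  fixes \<rho> :: "'g \<Rightarrow> 'g \<Rightarrow> 'v \<Rightarrow> 'v"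
    and \<nu> :: "'g \<Rightarrow> 'v \<Rightarrow> 'v \<Rightarrow> 'v"
  assumes rho_linear: "linear_wedge2_gl scale scaleV \<rho>"
    and nu_linear: "linear_hom_wedge2 scale scaleV \<nu>"
    and semidirect: "three_lie_algebra (module_prod.scale scale scaleV)
                       (semidirect_bracket bracket \<rho> \<nu>)"

locale generalized_matched_pair =
  g1: three_lie_algebra s1 br1 + g2: three_lie_algebra s2 br2 +
  rep1: generalized_representation s1 br1 s2 \<rho> \<nu> +
  rep2: generalized_representation s2 br2 s1 varrho \<tau>
  for s1 :: "'k::field_char_0 \<Rightarrow> 'g1::ab_group_add \<Rightarrow> 'g1"
    and br1 :: "'g1 \<Rightarrow> 'g1 \<Rightarrow> 'g1 \<Rightarrow> 'g1"
    and s2 :: "'k \<Rightarrow> 'g2::ab_group_add \<Rightarrow> 'g2"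
    and br2 :: "'g2 \<Rightarrow> 'g2 \<Rightarrow> 'g2 \<Rightarrow> 'g2"
    and \<rho> :: "'g1 \<Rightarrow> 'g1 \<Rightarrow> 'g2 \<Rightarrow> 'g2"
    and \<nu> :: "'g1 \<Rightarrow> 'g2 \<Rightarrow> 'g2 \<Rightarrow> 'g2"
    and varrho :: "'g2 \<Rightarrow> 'g2 \<Rightarrow> 'g1 \<Rightarrow> 'g1"
    and \<tau> :: "'g2 \<Rightarrow> 'g1 \<Rightarrow> 'g1 \<Rightarrow> 'g1" +
  assumes matched_1: "\<And>x1 x2 x3 a1 a2.
      \<nu> (br1 x1 x2 x3) a1 a2
      = \<rho> x1 x2 (\<nu> x3 a1 a2) + \<rho> x3 x1 (\<nu> x2 a1 a2) + \<rho> x2 x3 (\<nu> x1 a1 a2)"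
    and matched_2: "\<And>x1 x2 x3 a1 a2.
      varrho a1 a2 (br1 x1 x2 x3)
      = br1 (varrho a1 a2 x1) x2 x3 + br1 x1 (varrho a1 a2 x2) x3 + br1 x1 x2 (varrho a1 a2 x3)
        + \<tau> (\<nu> x1 a1 a2) x2 x3 + \<tau> (\<nu> x2 a1 a2) x3 x1 + \<tau> (\<nu> x3 a1 a2) x1 x2"
    and matched_3: "\<And>x1 x2 x3 a1 a2.
      br1 x1 x2 (varrho a1 a2 x3)
      = varrho (\<rho> x1 x2 a1) a2 x3 - varrho (\<rho> x1 x3 a2) a1 x2 + varrho (\<rho> x2 x3 a2) a1 x1
        - \<tau> (\<nu> x3 a1 a2) x1 x2"
    and matched_4: "\<And>x1 x2 x3 a1 a2.
      br1 (varrho a1 a2 x1) x2 x3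
      = varrho a1 a2 (br1 x1 x2 x3) + varrho (\<rho> x2 x3 a1) a2 x1 + varrho a1 (\<rho> x2 x3 a2) x1
        - \<tau> (\<nu> x1 a1 a2) x2 x3"
    and matched_5: "\<And>x1 x2 x3 x4 a1.
      br1 x1 x2 (\<tau> a1 x3 x4)
      = br1 x3 x4 (\<tau> a1 x1 x2) - \<tau> (\<rho> x3 x4 a1) x1 x2
        + \<tau> a1 (br1 x1 x2 x3) x4 + \<tau> a1 x3 (br1 x1 x2 x4) + \<tau> (\<rho> x1 x2 a1) x3 x4"
    and matched_6: "\<And>x1 x2 x3 x4 a1.
      \<tau> a1 x1 (br1 x2 x3 x4)
      = br1 (\<tau> a1 x1 x2) x3 x4 + br1 (\<tau> a1 x1 x3) x4 x2 + br1 (\<tau> a1 x1 x4) x2 x3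
        + \<tau> (\<rho> x1 x2 a1) x3 x4 + \<tau> (\<rho> x1 x3 a1) x4 x2 + \<tau> (\<rho> x1 x4 a1) x2 x3"
    and matched_7: "\<And>x1 x2 x3 a1 a2.
      \<rho> (\<tau> a2 x1 x2) x3 a1 = \<rho> (\<tau> a2 x3 x2) x1 a1 + \<rho> (\<tau> a2 x1 x3) x2 a1"
    and matched_8: "\<And>x1 x2 x3 a1 a2.
      \<rho> x1 (\<tau> a1 x2 x3) a2 = \<rho> x1 (\<tau> a2 x2 x3) a1"
    and matched_9: "\<And>a1 a2 a3 x1 x2.
      \<tau> (br2 a1 a2 a3) x1 x2
      = varrho a1 a2 (\<tau> a3 x1 x2) + varrho a3 a1 (\<tau> a2 x1 x2) + varrho a2 a3 (\<tau> a1 x1 x2)"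
    and matched_10: "\<And>a1 a2 a3 x1 x2.
      \<rho> x1 x2 (br2 a1 a2 a3)
      = br2 (\<rho> x1 x2 a1) a2 a3 + br2 a1 (\<rho> x1 x2 a2) a3 + br2 a1 a2 (\<rho> x1 x2 a3)
        + \<nu> (\<tau> a1 x1 x2) a2 a3 + \<nu> (\<tau> a2 x1 x2) a3 a1 + \<nu> (\<tau> a3 x1 x2) a1 a2"
    and matched_11: "\<And>a1 a2 a3 x1 x2.
      br2 a1 a2 (\<rho> x1 x2 a3)
      = \<rho> (varrho a1 a2 x1) x2 a3 - \<rho> (varrho a1 a3 x2) x1 a2 + \<rho> (varrho a2 a3 x2) x1 a1
        - \<nu> (\<tau> a3 x1 x2) a1 a2"
    and matched_12: "\<And>a1 a2 a3 x1 x2.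
      br2 (\<rho> x1 x2 a1) a2 a3
      = \<rho> x1 x2 (br2 a1 a2 a3) + \<rho> (varrho a2 a3 x1) x2 a1 + \<rho> x1 (varrho a2 a3 x2) a1
        - \<nu> (\<tau> a1 x1 x2) a2 a3"
    and matched_13: "\<And>a1 a2 a3 a4 x1.
      br2 a1 a2 (\<nu> x1 a3 a4)
      = \<nu> x1 (br2 a1 a2 a3) a4 + \<nu> x1 a3 (br2 a1 a2 a4) + br2 a3 a4 (\<nu> x1 a1 a2)
        + \<nu> (varrho a1 a2 x1) a3 a4 - \<nu> (varrho a3 a4 x1) a1 a2"
    and matched_14: "\<And>a1 a2 a3 a4 x1.
      \<nu> x1 a1 (br2 a2 a3 a4)
      = \<nu> (varrho a1 a2 x1) a3 a4 + \<nu> (varrho a1 a3 x1) a4 a2 + \<nu> (varrho a1 a4 x1) a2 a3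
        + br2 (\<nu> x1 a1 a2) a3 a4 + br2 (\<nu> x1 a1 a3) a4 a2 + br2 a2 a3 (\<nu> x1 a1 a4)"
    and matched_15: "\<And>a1 a2 a3 x1 x2.
      varrho (\<nu> x2 a1 a2) a3 x1 = varrho (\<nu> x2 a3 a2) a1 x1 + varrho (\<nu> x2 a1 a3) a2 x1"
    and matched_16: "\<And>a1 a2 a3 x1 x2.
      varrho a1 (\<nu> x1 a2 a3) x2 = varrho a1 (\<nu> x2 a2 a3) x1"

text \<open>
  The direct sum is modelled as the product type, \<open>x + a\<close> being \<open>(x, a)\<close>; the terms of the
  bracket are grouped by the summand in which they lie.
\<close>

fun matched_bracket ::
  "('g1 \<Rightarrow> 'g1 \<Rightarrow> 'g1 \<Rightarrow> 'g1) \<Rightarrow> ('g2 \<Rightarrow> 'g2 \<Rightarrow> 'g2 \<Rightarrow> 'g2)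
    \<Rightarrow> ('g1 \<Rightarrow> 'g1 \<Rightarrow> 'g2 \<Rightarrow> 'g2) \<Rightarrow> ('g1 \<Rightarrow> 'g2 \<Rightarrow> 'g2 \<Rightarrow> 'g2)
    \<Rightarrow> ('g2 \<Rightarrow> 'g2 \<Rightarrow> 'g1 \<Rightarrow> 'g1) \<Rightarrow> ('g2 \<Rightarrow> 'g1 \<Rightarrow> 'g1 \<Rightarrow> 'g1)
    \<Rightarrow> 'g1 \<times> 'g2 \<Rightarrow> 'g1 \<times> 'g2 \<Rightarrow> 'g1 \<times> 'g2 \<Rightarrow> ('g1::ab_group_add) \<times> ('g2::ab_group_add)" where
  "matched_bracket br1 br2 \<rho> \<nu> varrho \<tau> (x1, a1) (x2, a2) (x3, a3) =
     (br1 x1 x2 x3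
        + varrho a1 a2 x3 + varrho a2 a3 x1 + varrho a3 a1 x2
        + \<tau> a1 x2 x3 + \<tau> a2 x3 x1 + \<tau> a3 x1 x2,
      br2 a1 a2 a3
        + \<rho> x1 x2 a3 + \<rho> x2 x3 a1 + \<rho> x3 x1 a2
        + \<nu> x1 a2 a3 + \<nu> x2 a3 a1 + \<nu> x3 a1 a2)"

end

theory Submission
  imports Defs
begin

text \<open>
  The bracket on the sum is skew and multilinear, so only the fundamental identity needs an argument.
  The difference of its two sides (\<open>fi_defect\<close>) is again multilinear, skew in the first two arguments
  and skew in the last three. Such a function vanishes as soon as it vanishes on arguments lying
  in one of the two summands, one representative being enough for each way of distributing
  the summands over the two groups of arguments (\<open>fi_defect_eq_zero\<close>). There are twelve
  distributions: zero to two arguments from the second summand in the first group, zero to three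
  in the second.

  The notion of a generalized matched pair is symmetric: exchanging the two algebras exchanges the
  first eight compatibility conditions with the last eight, and exchanges the components of the
  bracket. So six distributions have to be checked, namely those where at most one of
  the last three arguments lies in the second summand.

  On arguments taken from the summands, most terms of the bracket vanish. The terms that never leave
  a semidirect product are handled by the fundamental identity for one of the two generalized
  representations. What remains are the terms that compose a map belonging to one
  representation with a map belonging to the other, and these cancel by the compatibility conditions.
\<close>

section \<open>Reduction of the fundamental identity to the summands\<close>

text \<open>
  Additivity splits the first argument; skew-symmetry then exchanges the arguments, so that the
  second one can be split in the same way.
\<close>

lemma skew_2_eq_zero:
  fixes f :: "'v::ab_group_add \<Rightarrow> 'v \<Rightarrow> 'w::ab_group_add"
  assumes add: "\<And>x x' y. f (x + x') y = f x y + f x' y"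
    and skew: "\<And>x y. f y x = - f x y"
    and sum: "\<And>v. \<exists>x\<in>A. \<exists>a\<in>B. v = x + a"
    and AA: "\<And>x y. \<lbrakk>x \<in> A; y \<in> A\<rbrakk> \<Longrightarrow> f x y = 0"
    and AB: "\<And>x b. \<lbrakk>x \<in> A; b \<in> B\<rbrakk> \<Longrightarrow> f x b = 0"
    and BB: "\<And>a b. \<lbrakk>a \<in> B; b \<in> B\<rbrakk> \<Longrightarrow> f a b = 0"
  shows "f u v = 0"
proof -
  have BA: "f b x = 0" if "x \<in> A" "b \<in> B" for x b
    using AB[OF that] skew[where x=x and y=b] by simp
  obtain x a where u: "u = x + a" "x \<in> A" "a \<in> B" using sum by blast
  obtain y b where v: "v = y + b" "y \<in> A" "b \<in> B" using sum by blast
  have z: "f w v = 0" if "w \<in> A \<union> B" for w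
  proof -
    have "f v w = 0"
      unfolding v(1) add using that v AA AB BB BA by auto
    then show ?thesis using skew[where x=v and y=w] by simp
  qed
  show ?thesis unfolding u(1) add using z u by simp
qed

text \<open>
  One representative per multiset of types suffices; the representatives are chosen so that the
  hypotheses are invariant under exchanging \<open>A\<close> and \<open>B\<close>.
\<close>

lemma skew_3_eq_zero:
  fixes f :: "'v::ab_group_add \<Rightarrow> 'v \<Rightarrow> 'v \<Rightarrow> 'w::ab_group_add"
  assumes add: "\<And>x x' y z. f (x + x') y z = f x y z + f x' y z"
    and skew12: "\<And>x y z. f y x z = - f x y z"
    and skew23: "\<And>x y z. f x z y = - f x y z"
    and sum: "\<And>v. \<exists>x\<in>A. \<exists>a\<in>B. v = x + a"
    and AAA: "\<And>x y z. \<lbrakk>x \<in> A; y \<in> A; z \<in> A\<rbrakk> \<Longrightarrow> f x y z = 0"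
    and AAB: "\<And>x y c. \<lbrakk>x \<in> A; y \<in> A; c \<in> B\<rbrakk> \<Longrightarrow> f x y c = 0"
    and BBA: "\<And>a b z. \<lbrakk>a \<in> B; b \<in> B; z \<in> A\<rbrakk> \<Longrightarrow> f a b z = 0"
    and BBB: "\<And>a b c. \<lbrakk>a \<in> B; b \<in> B; c \<in> B\<rbrakk> \<Longrightarrow> f a b c = 0"
  shows "f u v w = 0"
proof -
  have rotate: "f y z x = f x y z" for x y z
    using skew12[where x=x and y=y and z=z] skew23[where x=y and y=x and z=z] by simp
  have add2: "f y (x + x') z = f y x z + f y x' z" for x x' y z
    using add[of x x' y z] skew12[where x=x and y=y and z=z] skew12[where x=x' and y=y and z=z]
      skew12[where x="x+x'" and y=y and z=z] by simp
  have A: "f x v w = 0" if x: "x \<in> A" for x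
  proof (rule skew_2_eq_zero[where A=A and B=B and f="f x"])
    show "\<And>p p' q. f x (p + p') q = f x p q + f x p' q" by (rule add2)
    show "f x a b = 0" if "a \<in> B" "b \<in> B" for a b
      using BBA[OF that x] rotate[of a b x] by simp
  qed (use x AAA AAB skew23 sum in blast)+
  have B: "f a v w = 0" if a: "a \<in> B" for a
  proof (rule skew_2_eq_zero[where A=A and B=B and f="f a"])
    show "\<And>p p' q. f a (p + p') q = f a p q + f a p' q" by (rule add2)
    show "f a x y = 0" if "x \<in> A" "y \<in> A" for x y
      using AAB[OF that a] rotate[of x y a] by simp
    show "f a x b = 0" if "x \<in> A" "b \<in> B" for x b
      using BBA[OF a that(2,1)] skew23[where x=a and y=b and z=x] by simp
  qed (use a BBB skew23 sum in blast)+
  obtain x a where "u = x + a" "x \<in> A" "a \<in> B" using sum by blast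
  then show ?thesis by (simp add: add A B)
qed

definition fi_defect ::
  "('v::ab_group_add \<Rightarrow> 'v \<Rightarrow> 'v \<Rightarrow> 'v) \<Rightarrow> 'v \<Rightarrow> 'v \<Rightarrow> 'v \<Rightarrow> 'v \<Rightarrow> 'v \<Rightarrow> 'v" where
  "fi_defect br X1 X2 X3 X4 X5 =
     br X1 X2 (br X3 X4 X5)
     - (br (br X1 X2 X3) X4 X5 + br X3 (br X1 X2 X4) X5 + br X3 X4 (br X1 X2 X5))"

text \<open>
  The defect is skew in its first two and in its last three arguments, so the two preceding lemmas
  apply in turn, first to a fixed last triple and then to a fixed first pair. The order in which a
  mixed first pair is presented depends on the last triple, which makes the two hypotheses
  mirror images of each other.
\<close>

lemma fi_defect_eq_zero:
  fixes br :: "'v::ab_group_add \<Rightarrow> 'v \<Rightarrow> 'v \<Rightarrow> 'v"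
  assumes add: "\<And>x x' y z. br (x + x') y z = br x y z + br x' y z"
    and skew12: "\<And>x y z. br y x z = - br x y z"
    and skew23: "\<And>x y z. br x z y = - br x y z"
    and sum: "\<And>v. \<exists>x\<in>A. \<exists>a\<in>B. v = x + a"
    and pure_A: "\<And>X1 X2 X3 X4 X5.
        \<lbrakk>X1 \<in> A \<and> X2 \<in> A \<or> X1 \<in> A \<and> X2 \<in> B \<or> X1 \<in> B \<and> X2 \<in> B;
         X3 \<in> A; X4 \<in> A; X5 \<in> A \<union> B\<rbrakk> \<Longrightarrow> fi_defect br X1 X2 X3 X4 X5 = 0"
    and pure_B: "\<And>X1 X2 X3 X4 X5.
        \<lbrakk>X1 \<in> B \<and> X2 \<in> B \<or> X1 \<in> B \<and> X2 \<in> A \<or> X1 \<in> A \<and> X2 \<in> A;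
         X3 \<in> B; X4 \<in> B; X5 \<in> B \<union> A\<rbrakk> \<Longrightarrow> fi_defect br X1 X2 X3 X4 X5 = 0"
  shows "fi_defect br X1 X2 X3 X4 X5 = 0"
proof -
  have add2: "br x (y + y') z = br x y z + br x y' z" for x y y' z
    using add[of y y' x z] skew12[where x=x and y="y+y'" and z=z] skew12[where x=x and y=y and z=z]
      skew12[where x=x and y=y' and z=z] by (simp add: algebra_simps)
  have add3: "br x y (z + z') = br x y z + br x y z'" for x y z z'
    using add2[of x z z' y] skew23[where x=x and y=y and z="z+z'"] skew23[where x=x and y=y and z=z]
      skew23[where x=x and y=y and z=z'] by (simp add: algebra_simps)
  have minus1: "br (- x) y z = - br x y z" for x y z
    using add[of x "- x" y z] add[of 0 0 y z] by (simp add: eq_neg_iff_add_eq_0 add.commute)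
  have minus2: "br x (- y) z = - br x y z" for x y z
    using skew12[where x=x and y="-y" and z=z] skew12[where x=x and y=y and z=z] minus1[of y x z] 
    by simp
  have minus3: "br x y (- z) = - br x y z" for x y z
    using skew23[where x=x and y=y and z="-z"] skew23[where x=x and y=y and z=z] minus2[of x z y] 
    by simp
  note adds = add add2 add3 minus1 minus2 minus3
  have add_12: "fi_defect br (x + x') y Y3 Y4 Y5 = fi_defect br x y Y3 Y4 Y5 + fi_defect br x' y Y3 Y4 Y5"
    for x x' y Y3 Y4 Y5
    by (simp add: fi_defect_def adds algebra_simps)
  have skew_12: "fi_defect br y x Y3 Y4 Y5 = - fi_defect br x y Y3 Y4 Y5" for x y Y3 Y4 Y5
    by (simp add: fi_defect_def skew12[where x=x and y=y] adds algebra_simps)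
  have sum': "\<exists>a\<in>B. \<exists>x\<in>A. v = a + x" for v
    using sum[of v] by (metis add.commute)
  have inner_A: "fi_defect br Y1 Y2 Y3 Y4 Y5 = 0"
    if "Y3 \<in> A" "Y4 \<in> A" "Y5 \<in> A \<union> B" for Y1 Y2 Y3 Y4 Y5
    by (rule skew_2_eq_zero[where A=A and B=B and f="\<lambda>X1 X2. fi_defect br X1 X2 Y3 Y4 Y5"])
      (use add_12 skew_12 sum pure_A that in blast)+
  have inner_B: "fi_defect br Y1 Y2 Y3 Y4 Y5 = 0"
    if "Y3 \<in> B" "Y4 \<in> B" "Y5 \<in> B \<union> A" for Y1 Y2 Y3 Y4 Y5
    by (rule skew_2_eq_zero[where A=B and B=A and f="\<lambda>X1 X2. fi_defect br X1 X2 Y3 Y4 Y5"])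
      (use add_12 skew_12 sum' pure_B that in blast)+
  show ?thesis
  proof (rule skew_3_eq_zero[where A=A and B=B and f="fi_defect br X1 X2"])
    show "fi_defect br X1 X2 (x + x') y z = fi_defect br X1 X2 x y z + fi_defect br X1 X2 x' y z"
      for x x' y z
      by (simp add: fi_defect_def adds algebra_simps)
    show "fi_defect br X1 X2 y x z = - fi_defect br X1 X2 x y z" for x y z
      unfolding fi_defect_def
      using skew12[where x=x and y=y and z=z] skew12[where x=x and y="br X1 X2 y"]
        skew12[where x="br X1 X2 x" and y=y] skew12[where x=x and y=y and z="br X1 X2 z"]
      by (simp add: adds algebra_simps)
    show "fi_defect br X1 X2 x z y = - fi_defect br X1 X2 x y z" for x y z
      unfolding fi_defect_def
      using skew23[where x=x and y=y and z=z] skew23[where x=x and y=y and z="br X1 X2 z"]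
        skew23[where x=x and y="br X1 X2 y" and z=z] skew23[where x="br X1 X2 x" and y=y and z=z]
      by (simp add: adds algebra_simps)
  qed (use inner_A inner_B sum in blast)+
qed

section \<open>Multilinearity and skew-symmetry of the structure maps\<close>

lemma linear_wedge2_gl_linear:
  assumes "linear_wedge2_gl sg sv \<rho>"
  shows "Vector_Spaces.linear sg sv (\<lambda>x. \<rho> x y v)"
    and "Vector_Spaces.linear sg sv (\<lambda>y. \<rho> x y v)"
    and "Vector_Spaces.linear sv sv (\<lambda>v. \<rho> x y v)"
  using assms by (auto simp: linear_wedge2_gl_def)

lemma linear_hom_wedge2_linear:
  assumes "linear_hom_wedge2 sg sv \<nu>"
  shows "Vector_Spaces.linear sg sv (\<lambda>x. \<nu> x u v)"
    and "Vector_Spaces.linear sv sv (\<lambda>u. \<nu> x u v)"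
    and "Vector_Spaces.linear sv sv (\<lambda>v. \<nu> x u v)"
  using assms by (auto simp: linear_hom_wedge2_def)

lemma skew_if_biadditive_alternating:
  fixes f :: "'a::ab_group_add \<Rightarrow> 'a \<Rightarrow> 'b::ab_group_add"
  assumes "\<And>x x' y. f (x + x') y = f x y + f x' y"
    and "\<And>x y y'. f x (y + y') = f x y + f x y'"
    and alt: "\<And>x. f x x = 0"
  shows "f y x = - f x y"
  using alt[of "x + y"] alt[of x] alt[of y]
  by (simp add: assms(1,2) eq_neg_iff_add_eq_0 add.commute)

lemma linear_wedge2_gl_skew:
  assumes "linear_wedge2_gl sg sv \<rho>"
  shows "\<rho> y x v = - \<rho> x y v"
  by (rule skew_if_biadditive_alternating[where f="\<lambda>x y. \<rho> x y v"])
    (use assms in \<open>auto simp: linear_wedge2_gl_def Vector_Spaces.linear_iff\<close>)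

lemma linear_hom_wedge2_skew:
  assumes "linear_hom_wedge2 sg sv \<nu>"
  shows "\<nu> x v u = - \<nu> x u v"
  by (rule skew_if_biadditive_alternating[where f="\<nu> x"])
    (use assms in \<open>auto simp: linear_hom_wedge2_def Vector_Spaces.linear_iff\<close>)

lemma (in three_lie_algebra) bracket_rotate: "bracket y z x = bracket x y z"
  using skew_12[where x=x and y=y and z=z] skew_23[where x=y and y=x and z=z] by simp

context generalized_matched_pair
begin

lemmas structure_linear =
  g1.linear_1 g1.linear_2 g1.linear_3 g2.linear_1 g2.linear_2 g2.linear_3
  linear_wedge2_gl_linear[OF rep1.rho_linear] linear_hom_wedge2_linear[OF rep1.nu_linear]
  linear_wedge2_gl_linear[OF rep2.rho_linear] linear_hom_wedge2_linear[OF rep2.nu_linear]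

lemmas structure_add = structure_linear[THEN module_hom_linearI, THEN module_hom.add]
lemmas structure_scale = structure_linear[THEN module_hom_linearI, THEN module_hom.scale]
lemmas structure_zero = structure_linear[THEN module_hom_linearI, THEN module_hom.zero]
lemmas structure_neg = structure_linear[THEN module_hom_linearI, THEN module_hom.neg]

lemmas rho_skew = linear_wedge2_gl_skew[OF rep1.rho_linear]
lemmas varrho_skew = linear_wedge2_gl_skew[OF rep2.rho_linear]
lemmas nu_skew = linear_hom_wedge2_skew[OF rep1.nu_linear]
lemmas tau_skew = linear_hom_wedge2_skew[OF rep2.nu_linear]

abbreviation mbr where "mbr \<equiv> matched_bracket br1 br2 \<rho> \<nu> varrho \<tau>"

lemma mbr_skew_12: "mbr Y X Z = - mbr X Y Z"
proof -
  obtain x a y b z c where "X = (x, a)" "Y = (y, b)" "Z = (z, c)" by (metis prod.exhaust)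
  then show ?thesis
    by (simp add: g1.skew_12[of y x] g2.skew_12[of b a] rho_skew[of y x] rho_skew[of x z]
        rho_skew[of z y] varrho_skew[of b a] varrho_skew[of a c] varrho_skew[of c b]
        nu_skew[of _ b a] nu_skew[of _ a c] nu_skew[of _ c b]
        tau_skew[of _ y x] tau_skew[of _ x z] tau_skew[of _ z y])
qed

lemma mbr_skew_23: "mbr X Z Y = - mbr X Y Z"
proof -
  obtain x a y b z c where "X = (x, a)" "Y = (y, b)" "Z = (z, c)" by (metis prod.exhaust)
  then show ?thesis
    by (simp add: g1.skew_23[of x z y] g2.skew_23[of a c b] rho_skew[of y x] rho_skew[of x z]
        rho_skew[of z y] varrho_skew[of b a] varrho_skew[of a c] varrho_skew[of c b]
        nu_skew[of _ b a] nu_skew[of _ a c] nu_skew[of _ c b]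
        tau_skew[of _ y x] tau_skew[of _ x z] tau_skew[of _ z y])
qed

lemma mbr_add: "mbr (X + X') Y Z = mbr X Y Z + mbr X' Y Z"
  by (cases X; cases X'; cases Y; cases Z) (simp add: structure_add algebra_simps)

section \<open>The fundamental identity on the summands\<close>

abbreviation defect where "defect \<equiv> fi_defect mbr"

lemmas semidirect_fi1 = three_lie_algebra.fundamental_identity[OF rep1.semidirect]
lemmas semidirect_fi2 = three_lie_algebra.fundamental_identity[OF rep2.semidirect]

lemma defect_xx_xxx: "defect (x1, 0) (x2, 0) (x3, 0) (x4, 0) (x5, 0) = 0"
  by (simp add: fi_defect_def structure_zero zero_prod_def
      g1.fundamental_identity[of x1 x2 x3 x4 x5])

text \<open>
  In each of the following cases, the terms not accounted for by the \<open>semidirect_fi\<close> identities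
  cancel by the cited conditions, which are brought to the orientation of the goal
  by skew-symmetry; a condition is negated when this changes the sign of all its terms.
\<close>

lemma defect_xx_xxa: "defect (x1, 0) (x2, 0) (x3, 0) (x4, 0) (0, a5) = 0"
  using semidirect_fi1[of "(x1, 0)" "(x2, 0)" "(x3, 0)" "(x4, 0)" "(0, a5)"]
    matched_5[of x1 x2 a5 x3 x4]
  by (simp add: fi_defect_def structure_zero zero_prod_def)

lemma defect_xa_xxx: "defect (x1, 0) (0, a2) (x3, 0) (x4, 0) (x5, 0) = 0"
  using semidirect_fi1[of "(x1, 0)" "(0, a2)" "(x3, 0)" "(x4, 0)" "(x5, 0)"]
    arg_cong[where f=uminus, OF matched_6[of a2 x1 x3 x4 x5]]
  by (simp add: fi_defect_def structure_zero structure_neg zero_prod_def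
      tau_skew[of a2 x1] rho_skew[of x1]
      g1.bracket_rotate[of x3 _ x5] g1.bracket_rotate[of x3 x4] g1.bracket_rotate[of x5 x3]
      algebra_simps)

lemma defect_aa_xxx: "defect (0, a1) (0, a2) (x3, 0) (x4, 0) (x5, 0) = 0"
  using semidirect_fi1[of "(0, a1)" "(0, a2)" "(x3, 0)" "(x4, 0)" "(x5, 0)"]
    matched_2[of a1 a2 x3 x4 x5]
  by (simp add: fi_defect_def structure_zero zero_prod_def)

text \<open>
  Both semidirect products contribute here: \<open>\<tau> a2 (\<tau> a5 x3 x4) x1\<close> is a term of the
  second one. The terms \<open>\<rho> (\<tau> _ _ _)\<close> lie in neither and cancel by \<open>matched_7\<close>, once
  \<open>matched_8\<close> has moved \<open>a2\<close> to the same place in all of them.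
\<close>

lemma defect_xa_xxa: "defect (x1, 0) (0, a2) (x3, 0) (x4, 0) (0, a5) = 0"
  using semidirect_fi1[of "(x1, 0)" "(0, a2)" "(x3, 0)" "(x4, 0)" "(0, a5)"]
    semidirect_fi2[of "(0, x1)" "(a2, 0)" "(0, x3)" "(0, x4)" "(a5, 0)"]
    arg_cong[where f=uminus, OF matched_3[of x3 x4 a5 a2 x1]]
    matched_8[of x1 a2 x3 x4 a5] matched_7[of a2 x3 x4 x1 a5]
  by (simp add: fi_defect_def structure_zero structure_neg zero_prod_def
      varrho_skew[of a5 a2] nu_skew[of _ a5 a2] varrho_skew[of "\<rho> _ _ _"]
      rho_skew[of x1] rho_skew[of x3 "\<tau> _ _ _"] tau_skew[of a2 x1] algebra_simps)

text \<open>
  Three of the five arguments lie in the second algebra, so this is the mirror image of a case with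
  only two arguments there; hence the conditions come from the second half of the list.
\<close>

lemma defect_aa_xxa: "defect (0, a1) (0, a2) (x3, 0) (x4, 0) (0, a5) = 0"
  using semidirect_fi2[of "(a1, 0)" "(a2, 0)" "(0, x3)" "(0, x4)" "(a5, 0)"]
    semidirect_fi1[of "(0, a1)" "(0, a2)" "(x3, 0)" "(x4, 0)" "(0, a5)"]
    matched_12[of x3 x4 a5 a1 a2] matched_16[of a5 x3 a1 a2 x4]
  by (simp add: fi_defect_def structure_zero zero_prod_def
      g2.bracket_rotate[of _ _ a5] g2.bracket_rotate[of a1 a2]
      nu_skew[of _ _ a5] varrho_skew[of _ a5] eq_neg_iff_add_eq_0 algebra_simps)

lemma defect_pure_eq_zero:
  assumes "X1 \<in> UNIV \<times> {0} \<and> X2 \<in> UNIV \<times> {0} \<or> X1 \<in> UNIV \<times> {0} \<and> X2 \<in> {0} \<times> UNIV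
      \<or> X1 \<in> {0} \<times> UNIV \<and> X2 \<in> {0} \<times> UNIV"
    and "X3 \<in> UNIV \<times> {0}" "X4 \<in> UNIV \<times> {0}" "X5 \<in> UNIV \<times> {0} \<union> {0} \<times> UNIV"
  shows "defect X1 X2 X3 X4 X5 = 0"
  using assms
  by (auto simp: defect_xx_xxx defect_xx_xxa defect_xa_xxx defect_aa_xxx defect_xa_xxa
      defect_aa_xxa)

section \<open>Exchanging the two algebras\<close>

text \<open>
  The two halves of the list of conditions are mirror images literally, except that \<open>matched_13\<close>
  orders the terms of \<open>matched_5\<close> differently, and \<open>matched_14\<close> those of \<open>matched_6\<close>,
  with one bracket rotated.
\<close>

lemma swap_matched_pair: "generalized_matched_pair s2 br2 s1 br1 varrho \<tau> \<rho> \<nu>"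
proof (unfold_locales, goal_cases)
  case (5 a1 a2 a3 a4 x1)
  show ?case using matched_13[of a1 a2 x1 a3 a4] by (simp add: algebra_simps)
next
  case (6 a1 a2 a3 a4 x1)
  show ?case
    using matched_14[of x1 a1 a2 a3 a4] g2.bracket_rotate[of a2 a3 "\<nu> x1 a1 a4"]
    by (simp add: algebra_simps)
next
  case (13 x1 x2 x3 x4 a1)
  show ?case using matched_5[of x1 x2 a1 x3 x4] by (simp add: algebra_simps)
next
  case (14 x1 x2 x3 x4 a1)
  show ?case
    using matched_6[of a1 x1 x2 x3 x4] g1.bracket_rotate[of x2 x3 "\<tau> a1 x1 x4"]
    by (simp add: algebra_simps)
qed (fact matched_1 matched_2 matched_3 matched_4 matched_7 matched_8
    matched_9 matched_10 matched_11 matched_12 matched_15 matched_16)+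

end

lemma matched_bracket_swap:
  "matched_bracket br2 br1 varrho \<tau> \<rho> \<nu> (prod.swap X) (prod.swap Y) (prod.swap Z)
    = prod.swap (matched_bracket br1 br2 \<rho> \<nu> varrho \<tau> X Y Z)"
  by (cases X; cases Y; cases Z) simp

lemma fi_defect_matched_bracket_swap:
  "fi_defect (matched_bracket br2 br1 varrho \<tau> \<rho> \<nu>) (prod.swap X1) (prod.swap X2)
      (prod.swap X3) (prod.swap X4) (prod.swap X5)
    = prod.swap (fi_defect (matched_bracket br1 br2 \<rho> \<nu> varrho \<tau>) X1 X2 X3 X4 X5)"
  by (simp add: fi_defect_def matched_bracket_swap prod_eq_iff)

context generalized_matched_pair
begin

lemma sum_of_summands:
  "\<exists>x\<in>UNIV \<times> {0}. \<exists>a\<in>{0} \<times> UNIV. v = x + (a :: 'g1 \<times> 'g2)"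
  by (rule bexI[of _ "(fst v, 0)"], rule bexI[of _ "(0, snd v)"]) (auto simp: prod_eq_iff)

lemma defect_eq_zero: "defect X1 X2 X3 X4 X5 = 0"
proof (rule fi_defect_eq_zero[where A="UNIV \<times> {0}" and B="{0} \<times> UNIV"])
  fix X1 X2 X3 X4 X5 :: "'g1 \<times> 'g2"
  assume "X1 \<in> {0} \<times> UNIV \<and> X2 \<in> {0} \<times> UNIV \<or> X1 \<in> {0} \<times> UNIV \<and> X2 \<in> UNIV \<times> {0}
      \<or> X1 \<in> UNIV \<times> {0} \<and> X2 \<in> UNIV \<times> {0}"
    and "X3 \<in> {0} \<times> UNIV" "X4 \<in> {0} \<times> UNIV" "X5 \<in> {0} \<times> UNIV \<union> UNIV \<times> {0}"
  then have "prod.swap (defect X1 X2 X3 X4 X5) = 0"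
    unfolding fi_defect_matched_bracket_swap[symmetric]
    by (intro generalized_matched_pair.defect_pure_eq_zero[OF swap_matched_pair]) auto
  then show "defect X1 X2 X3 X4 X5 = 0"
    by (simp add: prod_eq_iff)
qed (fact mbr_add mbr_skew_12 mbr_skew_23 sum_of_summands defect_pure_eq_zero)+

section \<open>The twilled algebra\<close>

sublocale vector_space_prod s1 s2
  by unfold_locales

lemma mbr_linear_1: "Vector_Spaces.linear scale scale (\<lambda>X. mbr X Y Z)"
  unfolding Vector_Spaces.linear_iff
proof (intro conjI allI)
  show "mbr (scale c X) Y Z = scale c (mbr X Y Z)" for c X
    by (cases X; cases Y; cases Z)
      (simp add: scale_prod structure_scale g1.scale_right_distrib g2.scale_right_distrib)
qed (use p.vector_space_axioms mbr_add in auto)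

lemma three_lie_algebra_mbr: "three_lie_algebra scale mbr"
proof (intro three_lie_algebra.intro three_lie_algebra_axioms.intro)
  show "fd_vector_space scale"
    using rep1.semidirect by (rule three_lie_algebra.axioms(1))
  have neg: "Vector_Spaces.linear scale scale (\<lambda>X. - f X)"
    if "Vector_Spaces.linear scale scale f" for f
    using that by (simp add: Vector_Spaces.linear_iff)
  show "Vector_Spaces.linear scale scale (\<lambda>Y. mbr X Y Z)" for X Z
    using neg[OF mbr_linear_1[of X Z]] by (simp add: mbr_skew_12[of X])
  then show "Vector_Spaces.linear scale scale (\<lambda>Z. mbr X Y Z)" for X Y
    using neg[of "\<lambda>Z. mbr X Z Y"] by (simp add: mbr_skew_23[of X Y])
  show "mbr X1 X2 (mbr X3 X4 X5)
      = mbr (mbr X1 X2 X3) X4 X5 + mbr X3 (mbr X1 X2 X4) X5 + mbr X3 X4 (mbr X1 X2 X5)"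
    for X1 X2 X3 X4 X5
    using defect_eq_zero[of X1 X2 X3 X4 X5] by (simp add: fi_defect_def)
qed (fact mbr_linear_1 mbr_skew_12 mbr_skew_23)+

lemma twilled: "twilled_three_lie_algebra scale mbr (UNIV \<times> {0}) ({0} \<times> UNIV)"
proof (intro twilled_three_lie_algebra.intro twilled_three_lie_algebra_axioms.intro)
  show "p.subspace (UNIV \<times> {0})" "p.subspace ({0} \<times> UNIV)"
    by (intro subspace_Times g1.subspace_UNIV g2.subspace_UNIV g1.subspace_single_0
        g2.subspace_single_0)+
qed (auto simp: three_lie_algebra_mbr sum_of_summands structure_zero zero_prod_def)

end

theorem theorem3p7:
  fixes s1 :: "'k::{alg_closed_field, field_char_0} \<Rightarrow> 'g1::ab_group_add \<Rightarrow> 'g1"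
    and br1 :: "'g1 \<Rightarrow> 'g1 \<Rightarrow> 'g1 \<Rightarrow> 'g1"
    and s2 :: "'k \<Rightarrow> 'g2::ab_group_add \<Rightarrow> 'g2"
    and br2 :: "'g2 \<Rightarrow> 'g2 \<Rightarrow> 'g2 \<Rightarrow> 'g2"
    and \<rho> :: "'g1 \<Rightarrow> 'g1 \<Rightarrow> 'g2 \<Rightarrow> 'g2"
    and \<nu> :: "'g1 \<Rightarrow> 'g2 \<Rightarrow> 'g2 \<Rightarrow> 'g2"
    and varrho :: "'g2 \<Rightarrow> 'g2 \<Rightarrow> 'g1 \<Rightarrow> 'g1"
    and \<tau> :: "'g2 \<Rightarrow> 'g1 \<Rightarrow> 'g1 \<Rightarrow> 'g1"
  assumes "generalized_matched_pair s1 br1 s2 br2 \<rho> \<nu> varrho \<tau>"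
  shows "twilled_three_lie_algebra (module_prod.scale s1 s2)
           (matched_bracket br1 br2 \<rho> \<nu> varrho \<tau>) (UNIV \<times> {0}) ({0} \<times> UNIV)"
  by (rule generalized_matched_pair.twilled[OF assms])

end
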